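(* A non-zero solution $\alpha\in\mathbb{Z}[\zeta]$ to the norm equation $N(\alpha)=r$ exists only for positive integers $r$ with the prime decomposition $$r=2^{2\varrho(2)}3^{2\varrho(3)}\prod_i p_i^{\varrho(p_i)}\prod_j q_j^{2\varrho(q_j)}\prod_k w_k^{2\varrho(w_k)}\prod_l z_l^{2\varrho(z_l)},$$ where the exponent values $\varrho(\cdot)$ are non-negative integers and $p_i,q_j,w_k,z_l$ are rational primes with $p_i\bmod 12=1$, $q_j\bmod 12=11$, $w_k\bmod 12=5$ and $z_l\bmod 12=7$.
   Context: $\zeta=(\sqrt{3}+\sqrt{-1})/2$ is a primitive 12-th root of unity ($\zeta=\sqrt[6]{-1}$), and $N(\alpha)$ is the norm of $\alpha\in\mathbb{Z}[\zeta]$, the product of its 4 Galois conjugates in $\mathbb{Q}[\zeta]$. *)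

theory Defs
  imports Complex_Main "HOL-Computational_Algebra.Polynomial"
    "HOL-Computational_Algebra.Primes" "HOL-Library.FuncSet"
begin

definition zeta :: complex where
  "zeta = (complex_of_real (sqrt 3) + \<i>) / 2"

definition Z_zeta :: "complex set" where
  "Z_zeta = {poly (map_poly of_int f) zeta | f :: int poly. True}"

definition Q_zeta :: "complex set" where
  "Q_zeta = {poly (map_poly of_rat f) zeta | f :: rat poly. True}"

(* Automorphisms are made extensional so that each field automorphism of Q_zeta is
   represented by exactly one HOL function; otherwise the set would be infinite and
   the product in the norm would collapse to 1. *)
definition Gal_zeta :: "(complex \<Rightarrow> complex) set" where
  "Gal_zeta = {\<sigma> \<in> extensional Q_zeta.
     bij_betw \<sigma> Q_zeta Q_zeta \<and>
     (\<forall>q::rat. \<sigma> (of_rat q) = of_rat q) \<and>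
     (\<forall>x\<in>Q_zeta. \<forall>y\<in>Q_zeta. \<sigma> (x + y) = \<sigma> x + \<sigma> y) \<and>
     (\<forall>x\<in>Q_zeta. \<forall>y\<in>Q_zeta. \<sigma> (x * y) = \<sigma> x * \<sigma> y)}"

(* The product runs over automorphisms, so coinciding conjugates are counted with
   multiplicity. *)
definition norm_zeta :: "complex \<Rightarrow> complex" where
  "norm_zeta \<alpha> = (\<Prod>\<sigma>\<in>Gal_zeta. \<sigma> \<alpha>)"

end

theory Submission imports Defs "HOL-Number_Theory.Residues" begin

text \<open>
  The field \<open>\<rat>(\<zeta>)\<close> contains the two imaginary quadratic fields \<open>\<rat>(\<i>)\<close> and \<open>\<rat>(\<omega>)\<close>,
  where \<open>\<omega> = \<zeta>\<^sup>2\<close> is a primitive sixth root of unity and \<open>\<i> = \<zeta>\<^sup>3\<close>. The norm factors through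
  each of them, so the norm of an algebraic integer is at once a norm from \<open>\<int>[\<i>]\<close>, that is, a sum
  of two squares \<open>x\<^sup>2 + y\<^sup>2\<close>, and a norm from \<open>\<int>[\<omega>]\<close>, that is, a value of \<open>u\<^sup>2 + u v + v\<^sup>2\<close>
  (lemmas \<open>norm_zeta_gauss_form\<close> and \<open>norm_zeta_eisenstein_form\<close>).

  A prime that is \<open>3\<close> modulo \<open>4\<close> is inert in \<open>\<int>[\<i>]\<close>: it divides \<open>x\<^sup>2 + y\<^sup>2\<close> only if it
  divides both \<open>x\<close> and \<open>y\<close>. Dividing out its square repeatedly shows that its exponent in a
  nonzero sum of two squares is even. In the same way a prime that is \<open>2\<close> modulo \<open>3\<close> has even
  exponent in every nonzero value of \<open>u\<^sup>2 + u v + v\<^sup>2\<close>. The first family contains \<open>3\<close> and the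
  primes that are \<open>7\<close> or \<open>11\<close> modulo \<open>12\<close>, the second one \<open>2\<close> and the primes that are \<open>5\<close> or
  \<open>11\<close>; together they contain every prime that is not \<open>1\<close> modulo \<open>12\<close>
  (lemma \<open>even_multiplicity_of_both_forms\<close>).

  To evaluate the product over the Galois group, elements are written as
  \<open>(a + b \<i>) + (c + d \<i>) \<omega>\<close> with rational coordinates. The coordinates are unique because
  \<open>sqrt 3\<close> is irrational, and the automorphisms are exactly the four maps that keep the
  coordinates and replace \<open>\<i>\<close> by \<open>\<plusminus>\<i>\<close> and \<open>\<omega>\<close> by \<open>\<omega>\<close> or \<open>1 - \<omega>\<close> (lemma \<open>Gal_zeta_eq\<close>).
  Multiplying the four conjugates in pairs, first over \<open>\<omega>\<close> or first over \<open>\<i>\<close>, gives the two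
  forms.
\<close>

section \<open>Primes dividing two binary quadratic forms\<close>

lemma fermat_int:
  fixes p :: nat and a :: int
  assumes "prime p" and "\<not> int p dvd a"
  shows "[a ^ (p - 1) = 1] (mod int p)"
proof -
  define b where "b = nat (a mod int p)"
  have p: "p > 0" using assms(1) by (simp add: prime_gt_0_nat)
  have b: "int b = a mod int p" using p by (simp add: b_def)
  have "\<not> p dvd b"
  proof
    assume "p dvd b"
    then have "int p dvd a mod int p" using b by (metis of_nat_dvd_iff)
    then show False using assms(2) by (simp add: dvd_mod_iff)
  qed
  then have "[b ^ (p - 1) = 1] (mod p)" using fermat_theorem[OF assms(1)] by blast
  then have "[int b ^ (p - 1) = 1] (mod int p)"
    by (metis cong_int_iff of_nat_1 of_nat_power)
  moreover have "[a = int b] (mod int p)" by (simp add: b cong_def)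
  ultimately show ?thesis by (meson cong_pow cong_trans)
qed

text \<open>
  Otherwise \<open>x\<^sup>2 \<equiv> - y\<^sup>2\<close> with both sides invertible. Raising this to the odd power
  \<open>(p - 1) / 2\<close> turns it into \<open>1 \<equiv> - 1\<close> by Fermat's little theorem.
\<close>
lemma prime_dvd_sum_squares:
  fixes p :: nat and x y :: int
  assumes p: "prime p" "p mod 4 = 3" and dvd: "int p dvd x\<^sup>2 + y\<^sup>2"
  shows "int p dvd x \<and> int p dvd y"
proof (rule ccontr)
  assume neg: "\<not> (int p dvd x \<and> int p dvd y)"
  have pr: "prime (int p)" using p(1) by simp
  have "int p dvd x \<longleftrightarrow> int p dvd y"
    using dvd pr by (metis dvd_add_right_iff dvd_add_left_iff prime_dvd_power_iff zero_less_numeral)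
  with neg have nx: "\<not> int p dvd x" and ny: "\<not> int p dvd y" by auto
  obtain j where j: "p = 4 * j + 3" using p(2) by (metis mult_div_mod_eq)
  define k where "k = 2 * j + 1"
  have k: "2 * k = p - 1" "odd k" by (simp_all add: j k_def)
  have "[x\<^sup>2 = - y\<^sup>2] (mod int p)" using dvd by (simp add: cong_iff_dvd_diff)
  then have "[(x\<^sup>2) ^ k = (- y\<^sup>2) ^ k] (mod int p)" by (rule cong_pow)
  then have "[x ^ (p - 1) = - (y ^ (p - 1))] (mod int p)"
    using k by (simp flip: power_mult)
  moreover have "[- (y ^ (p - 1)) = - 1] (mod int p)"
    using fermat_int[OF p(1) ny] by (simp add: cong_minus_minus_iff)
  ultimately have "[1 = - 1] (mod int p)"
    using fermat_int[OF p(1) nx] by (meson cong_sym cong_trans)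
  then have "int p dvd 2" by (simp add: cong_iff_dvd_diff)
  then have "p \<le> 2" using zdvd_imp_le by fastforce
  with p show False by (cases "p = 2") (auto dest: prime_ge_2_nat)
qed

text \<open>
  The form divides \<open>x\<^sup>3 - y\<^sup>3\<close>, and cubing is injective modulo \<open>p\<close> because \<open>3\<close> is prime to
  \<open>p - 1\<close>; hence \<open>x \<equiv> y\<close>. The value of the form is then \<open>3 x\<^sup>2\<close> modulo \<open>p\<close>, and \<open>p \<noteq> 3\<close>.
\<close>
lemma prime_dvd_eisenstein_form:
  fixes p :: nat and x y :: int
  assumes p: "prime p" "p mod 3 = 2" and dvd: "int p dvd x\<^sup>2 + x * y + y\<^sup>2"
  shows "int p dvd x \<and> int p dvd y"
proof (rule ccontr)
  assume neg: "\<not> (int p dvd x \<and> int p dvd y)"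
  have pr: "prime (int p)" using p(1) by simp
  have dvd': "int p dvd x * (x + y) + y\<^sup>2" "int p dvd x\<^sup>2 + y * (x + y)"
    using dvd by (simp_all add: algebra_simps power2_eq_square)
  have "int p dvd x \<longleftrightarrow> int p dvd y"
    using dvd' pr by (metis dvd_add_right_iff dvd_add_left_iff dvd_mult2 prime_dvd_power_iff zero_less_numeral)
  with neg have nx: "\<not> int p dvd x" and ny: "\<not> int p dvd y" by auto
  obtain k where "p = 3 * k + 2" using p(2) by (metis mult_div_mod_eq)
  then have k: "p - 1 = Suc (3 * k)" by simp
  have "x ^ 3 - y ^ 3 = (x - y) * (x\<^sup>2 + x * y + y\<^sup>2)"
    by (simp add: algebra_simps power2_eq_square power3_eq_cube)
  then have "[x ^ 3 = y ^ 3] (mod int p)" using dvd by (simp add: cong_iff_dvd_diff)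
  then have "[(x ^ 3) ^ k = (y ^ 3) ^ k] (mod int p)" by (rule cong_pow)
  then have *: "[x ^ (3 * k) = y ^ (3 * k)] (mod int p)" by (simp add: power_mult)
  have fx: "[x * x ^ (3 * k) = 1] (mod int p)" and fy: "[y * y ^ (3 * k) = 1] (mod int p)"
    using fermat_int[OF p(1) nx] fermat_int[OF p(1) ny] k by simp_all
  \<comment> \<open>\<open>x\<close> and \<open>y\<close> are inverse to the same residue \<open>x ^ (3 * k)\<close>, so they agree.\<close>
  have "[y * x ^ (3 * k) = y * y ^ (3 * k)] (mod int p)"
    using * by (rule cong_scalar_left)
  then have "[x * x ^ (3 * k) = y * x ^ (3 * k)] (mod int p)"
    using fx fy by (meson cong_sym cong_trans)
  then have "int p dvd (x - y) * x ^ (3 * k)" by (simp add: cong_iff_dvd_diff algebra_simps)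
  then have xy: "int p dvd x - y" using nx pr by (metis prime_dvd_mult_iff prime_dvd_power)
  have "3 * x\<^sup>2 = (x\<^sup>2 + x * y + y\<^sup>2) + (x - y) * (2 * x + y)"
    by (simp add: algebra_simps power2_eq_square)
  then have "int p dvd 3 * x\<^sup>2" using dvd xy by (metis dvd_add dvd_mult2)
  then have "int p dvd 3" using nx pr by (metis prime_dvd_mult_iff prime_dvd_power)
  then have "p dvd 3" by (metis of_nat_dvd_iff of_nat_numeral)
  then have "p \<le> 3" by (auto dest: dvd_imp_le)
  with \<open>p dvd 3\<close> p show False by (cases "p = 3"; cases "p = 2") (auto dest: prime_ge_2_nat)
qed

text \<open>
  Descent: if \<open>p\<close> divides a value of \<open>F\<close>, both arguments can be divided by \<open>p\<close>, and the
  value loses exactly the factor \<open>p\<^sup>2\<close>.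
\<close>
lemma even_multiplicity_anisotropic:
  fixes p :: int and F :: "int \<Rightarrow> int \<Rightarrow> int"
  assumes p: "prime p" and homog: "\<And>x y. F (p * x) (p * y) = p\<^sup>2 * F x y"
    and aniso: "\<And>x y. p dvd F x y \<Longrightarrow> p dvd x \<and> p dvd y"
    and "F x y \<noteq> 0"
  shows "even (multiplicity p (F x y))"
  using \<open>F x y \<noteq> 0\<close>
proof (induction "multiplicity p (F x y)" arbitrary: x y rule: less_induct)
  case less
  show ?case
  proof (cases "p dvd F x y")
    case True
    then obtain x' y' where xy: "x = p * x'" "y = p * y'" using aniso by (metis dvdE)
    have F: "F x y = p\<^sup>2 * F x' y'" by (simp add: xy homog)
    then have nz: "F x' y' \<noteq> 0" using less.prems by auto
    have m: "multiplicity p (F x y) = 2 + multiplicity p (F x' y')"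
    proof -
      have "p \<noteq> 0" using p by auto
      then show ?thesis
        using p nz unfolding F
        by (subst prime_elem_multiplicity_mult_distrib)
          (auto simp: prime_elem_multiplicity_power_distrib multiplicity_prime)
    qed
    show ?thesis using less.hyps[OF _ nz] m by simp
  qed (simp add: not_dvd_imp_multiplicity_0)
qed

lemma multiplicity_int_eq: "multiplicity (int p) (int n) = multiplicity p n"
proof -
  have "int p ^ k dvd int n \<longleftrightarrow> p ^ k dvd n" for k
    by (metis of_nat_dvd_iff of_nat_power)
  then show ?thesis unfolding multiplicity_def by simp
qed

lemma prime_mod_12:
  fixes p :: nat
  assumes "prime p"
  shows "p \<in> {2, 3} \<or> p mod 12 \<in> {1, 5, 7, 11}"
proof (cases "p \<in> {2, 3}")
  case False
  then have "\<not> 2 dvd p" "\<not> 3 dvd p"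
    using primes_dvd_imp_eq[of 2 p] primes_dvd_imp_eq[of 3 p] assms by auto
  then have "p mod 12 mod 2 \<noteq> 0" "p mod 12 mod 3 \<noteq> 0"
    by (simp_all add: mod_mod_cancel dvd_eq_mod_eq_0)
  moreover have "p mod 12 \<in> {0, 1, 2, 3, 4, 5, 6, 7, 8, 9, 10, 11}"
  proof -
    have "r \<in> {0, 1, 2, 3, 4, 5, 6, 7, 8, 9, 10, 11}" if "r < 12" for r :: nat
      using that by (simp add: numeral_eq_Suc less_Suc_eq)
    then show ?thesis by simp
  qed
  ultimately show ?thesis by (elim insertE) simp_all
qed simp

text \<open>
  A prime that is inert neither in \<open>\<int>[\<i>]\<close> nor in \<open>\<int>[\<omega>]\<close> is \<open>1\<close> modulo \<open>4\<close> and modulo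
  \<open>3\<close>: the ramified primes \<open>2\<close> and \<open>3\<close> are each inert in the other ring.
\<close>
lemma even_multiplicity_of_both_forms:
  fixes n p :: nat and x y u v :: int
  assumes n: "n > 0" and gauss: "int n = x\<^sup>2 + y\<^sup>2" and eisen: "int n = u\<^sup>2 + u * v + v\<^sup>2"
    and p: "prime p" "p mod 12 \<noteq> 1"
  shows "even (multiplicity p n)"
proof -
  have pr: "prime (int p)" using p(1) by simp
  consider "p mod 4 = 3" | "p mod 3 = 2"
  proof -
    define r where "r = p mod 12"
    have "p mod 4 = r mod 4" "p mod 3 = r mod 3" by (simp_all add: r_def mod_mod_cancel)
    moreover have "p = 2 \<or> p = 3 \<or> r = 5 \<or> r = 7 \<or> r = 11"
      using prime_mod_12[OF p(1)] p(2) unfolding r_def by blast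
    moreover have "(2 :: nat) mod 3 = 2" "(3 :: nat) mod 4 = 3" "(5 :: nat) mod 3 = 2"
      "(7 :: nat) mod 4 = 3" "(11 :: nat) mod 4 = 3" by simp_all
    ultimately have "p mod 4 = 3 \<or> p mod 3 = 2" by metis
    then show ?thesis using that by blast
  qed
  then have "even (multiplicity (int p) (int n))"
  proof cases
    case 1
    have "even (multiplicity (int p) (x\<^sup>2 + y\<^sup>2))"
    proof (rule even_multiplicity_anisotropic[OF pr, where F = "\<lambda>x y. x\<^sup>2 + y\<^sup>2"])
      show "x\<^sup>2 + y\<^sup>2 \<noteq> 0" using n by (simp flip: gauss)
    next
      show "\<And>x y. int p dvd x\<^sup>2 + y\<^sup>2 \<Longrightarrow> int p dvd x \<and> int p dvd y"
        by (rule prime_dvd_sum_squares[OF p(1) 1])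
    qed (simp add: power_mult_distrib distrib_left)
    then show ?thesis by (simp only: gauss)
  next
    case 2
    have "even (multiplicity (int p) (u\<^sup>2 + u * v + v\<^sup>2))"
    proof (rule even_multiplicity_anisotropic[OF pr, where F = "\<lambda>u v. u\<^sup>2 + u * v + v\<^sup>2"])
      show "u\<^sup>2 + u * v + v\<^sup>2 \<noteq> 0" using n by (simp flip: eisen)
    next
      show "\<And>u v. int p dvd u\<^sup>2 + u * v + v\<^sup>2 \<Longrightarrow> int p dvd u \<and> int p dvd v"
        by (rule prime_dvd_eisenstein_form[OF p(1) 2])
    qed (simp add: power2_eq_square algebra_simps)
    then show ?thesis by (simp only: eisen)
  qed
  then show ?thesis by (simp add: multiplicity_int_eq)
qed

section \<open>Grouping the prime factors by residue class\<close>

lemma prime_decomposition_of_even_multiplicities: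
  fixes n :: nat
  assumes n: "n > 0" and even: "\<And>p. prime p \<Longrightarrow> p mod 12 \<noteq> 1 \<Longrightarrow> even (multiplicity p n)"
  shows "\<exists>(\<rho> :: nat \<Rightarrow> nat) P Q W Z.
       finite P \<and> finite Q \<and> finite W \<and> finite Z \<and>
       (\<forall>p\<in>P. prime p \<and> p mod 12 = 1) \<and>
       (\<forall>q\<in>Q. prime q \<and> q mod 12 = 11) \<and>
       (\<forall>w\<in>W. prime w \<and> w mod 12 = 5) \<and>
       (\<forall>z\<in>Z. prime z \<and> z mod 12 = 7) \<and>
       n = 2 ^ (2 * \<rho> 2) * 3 ^ (2 * \<rho> 3) *
           (\<Prod>p\<in>P. p ^ \<rho> p) * (\<Prod>q\<in>Q. q ^ (2 * \<rho> q)) *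
           (\<Prod>w\<in>W. w ^ (2 * \<rho> w)) * (\<Prod>z\<in>Z. z ^ (2 * \<rho> z))"
proof -
  define m where "m p = multiplicity p n" for p
  define \<rho> where "\<rho> p = (if p mod 12 = 1 then m p else m p div 2)" for p
  define S where "S r = {p \<in> prime_factors n. p mod 12 = r}" for r
  have fin: "finite (S r)" for r by (simp add: S_def)
  have S: "prime p \<and> p mod 12 = r" if "p \<in> S r" for p r
    using that by (auto simp: S_def)
  have even': "p ^ (2 * \<rho> p) = p ^ m p" if "prime p" "p mod 12 \<noteq> 1" for p
    using even[OF that] that(2) by (simp add: \<rho>_def m_def)
  \<comment> \<open>Adjoining \<open>2\<close> and \<open>3\<close>, possibly with exponent \<open>0\<close>, makes their two factors appear even
    when they do not divide \<open>n\<close>.\<close>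
  have cover: "prime_factors n \<union> {2, 3} = {2, 3} \<union> (S 1 \<union> (S 11 \<union> (S 5 \<union> S 7)))"
    using prime_mod_12 in_prime_factors_imp_prime unfolding S_def by blast
  have "n = (\<Prod>p\<in>prime_factors n. p ^ m p)"
    using prime_factorization_nat n unfolding m_def by blast
  also have "\<dots> = (\<Prod>p\<in>prime_factors n \<union> {2, 3}. p ^ m p)"
  proof (rule prod.mono_neutral_left)
    show "\<forall>p\<in>prime_factors n \<union> {2, 3} - prime_factors n. p ^ m p = 1"
    proof
      fix p assume "p \<in> prime_factors n \<union> {2, 3} - prime_factors n"
      then have "p \<in> {2, 3}" "p \<notin> prime_factors n" by auto
      then have "\<not> p dvd n" using n by (auto simp: prime_factors_dvd)
      then show "p ^ m p = 1" by (simp add: m_def not_dvd_imp_multiplicity_0)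
    qed
  qed auto
  also have "\<dots> = (\<Prod>p\<in>{2, 3}. p ^ m p) * ((\<Prod>p\<in>S 1. p ^ m p) *
      ((\<Prod>p\<in>S 11. p ^ m p) * ((\<Prod>p\<in>S 5. p ^ m p) * (\<Prod>p\<in>S 7. p ^ m p))))"
  proof -
    have disj: "S r \<inter> S s = {}" if "r \<noteq> s" for r s using that by (auto simp: S_def)
    have disj': "{2, 3} \<inter> S r = {}" if "r \<noteq> 2" "r \<noteq> 3" for r
      using that by (auto simp: S_def)
    show ?thesis
      unfolding cover by (simp add: prod.union_disjoint fin disj disj' Int_Un_distrib
          del: Un_insert_left prod.insert)
  qed
  also have "(\<Prod>p\<in>{2, 3}. p ^ m p) = 2 ^ (2 * \<rho> 2) * 3 ^ (2 * \<rho> 3)"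
    using even'[of 2] even'[of 3] by simp
  also have "(\<Prod>p\<in>S 1. p ^ m p) = (\<Prod>p\<in>S 1. p ^ \<rho> p)"
    using S by (intro prod.cong) (auto simp: \<rho>_def)
  also have "(\<Prod>p\<in>S 11. p ^ m p) = (\<Prod>p\<in>S 11. p ^ (2 * \<rho> p))"
    using S even' by (intro prod.cong) force+
  also have "(\<Prod>p\<in>S 5. p ^ m p) = (\<Prod>p\<in>S 5. p ^ (2 * \<rho> p))"
    using S even' by (intro prod.cong) force+
  also have "(\<Prod>p\<in>S 7. p ^ m p) = (\<Prod>p\<in>S 7. p ^ (2 * \<rho> p))"
    using S even' by (intro prod.cong) force+
  finally have "n = 2 ^ (2 * \<rho> 2) * 3 ^ (2 * \<rho> 3) *
      (\<Prod>p\<in>S 1. p ^ \<rho> p) * (\<Prod>p\<in>S 11. p ^ (2 * \<rho> p)) *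
      (\<Prod>p\<in>S 5. p ^ (2 * \<rho> p)) * (\<Prod>p\<in>S 7. p ^ (2 * \<rho> p))"
    by (simp only: mult.assoc)
  then show ?thesis
    by (intro exI[of _ \<rho>] exI[of _ "S 1"] exI[of _ "S 11"] exI[of _ "S 5"] exI[of _ "S 7"]
        conjI ballI fin) (auto dest: S)
qed

section \<open>Coordinates over the rationals\<close>

lemma sqrt_3_irrational: "sqrt 3 \<notin> \<rat>"
proof
  assume "sqrt 3 \<in> \<rat>"
  then obtain a b :: int where ab: "b \<noteq> 0" "sqrt 3 = of_int a / of_int b"
    by (metis Rats_cases' of_int_0_less_iff less_irrefl)
  then have "real_of_int a = sqrt 3 * of_int b" by (simp add: field_simps)
  then have "(real_of_int a)\<^sup>2 = 3 * (of_int b)\<^sup>2" by (simp add: power_mult_distrib)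
  then have eq: "a\<^sup>2 = 3 * b\<^sup>2" by (metis of_int_eq_iff of_int_mult of_int_numeral of_int_power)
  have "a \<noteq> 0" using eq ab(1) by auto
  then have "multiplicity 3 (a\<^sup>2) = 2 * multiplicity 3 a"
    by (simp add: prime_elem_multiplicity_power_distrib)
  moreover have "multiplicity 3 (3 * b\<^sup>2) = Suc (2 * multiplicity 3 b)"
    using ab(1) by (simp add: prime_elem_multiplicity_mult_distrib prime_elem_multiplicity_power_distrib)
  ultimately show False by (metis eq even_Suc even_mult_iff even_numeral)
qed

text \<open>
  The arguments \<open>I\<close> and \<open>W\<close> are kept variable, so that one formula describes an element and
  all its conjugates: conjugation moves the pair \<open>(I, W)\<close> and fixes the coordinates.
\<close>
definition biquad :: "complex \<Rightarrow> complex \<Rightarrow> complex \<Rightarrow> complex \<Rightarrow> complex \<Rightarrow> complex \<Rightarrow> complex" where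
  "biquad I W a b c d = (a + b * I) + (c + d * I) * W"

text \<open>
  \<open>\<plusminus>\<i>\<close> are the roots of \<open>X\<^sup>2 + 1\<close>; \<open>\<zeta>\<^sup>2\<close> and \<open>1 - \<zeta>\<^sup>2\<close> are the roots of \<open>X\<^sup>2 - X + 1\<close>.
\<close>
definition root_pairs :: "(complex \<times> complex) set" where
  "root_pairs = {\<i>, - \<i>} \<times> {zeta\<^sup>2, 1 - zeta\<^sup>2}"

lemma zeta_cube: "zeta ^ 3 = \<i>"
proof -
  have s: "complex_of_real (sqrt 3) * complex_of_real (sqrt 3) = 3"
    by (simp flip: of_real_mult)
  have "8 * zeta ^ 3 = (complex_of_real (sqrt 3) + \<i>) ^ 3"
    by (simp add: zeta_def power_divide)
  also have "\<dots> = (complex_of_real (sqrt 3) * complex_of_real (sqrt 3) - 3) * complex_of_real (sqrt 3)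
      + (3 * (complex_of_real (sqrt 3) * complex_of_real (sqrt 3)) - 1) * \<i>"
    by (simp add: power3_eq_cube algebra_simps)
  also have "\<dots> = 8 * \<i>" unfolding s by simp
  finally show ?thesis by simp
qed

lemma zeta_square: "zeta\<^sup>2 = Complex (1 / 2) (sqrt 3 / 2)"
  by (simp add: zeta_def complex_eq_iff power2_eq_square field_simps flip: of_real_mult)

lemma zeta_square_square: "zeta\<^sup>2 * zeta\<^sup>2 = zeta\<^sup>2 - 1"
  by (simp add: zeta_square complex_eq_iff)

text \<open>
  This gives multiplication by \<open>\<zeta>\<close> in the coordinates of \<open>biquad\<close>.
\<close>
lemma zeta_eq: "zeta = \<i> * (1 - zeta\<^sup>2)"
  by (simp add: zeta_square) (simp add: zeta_def complex_eq_iff)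

lemma root_pairs_relations:
  assumes "(I, W) \<in> root_pairs"
  shows "I * I = - 1" "W * W = W - 1"
proof -
  have "I = \<i> \<or> I = - \<i>" "W = zeta\<^sup>2 \<or> W = 1 - zeta\<^sup>2"
    using assms by (auto simp: root_pairs_def)
  moreover have "(1 - zeta\<^sup>2) * (1 - zeta\<^sup>2) = (1 - zeta\<^sup>2) - 1"
    using zeta_square_square by Groebner_Basis.algebra
  ultimately show "I * I = - 1" "W * W = W - 1"
    using zeta_square_square by auto
qed

lemma Rats_independent_sqrt_3:
  fixes x y :: real
  assumes "x \<in> \<rat>" "y \<in> \<rat>" "x + y * sqrt 3 = 0"
  shows "x = 0" "y = 0"
proof -
  show "y = 0"
  proof (rule ccontr)
    assume "y \<noteq> 0"
    then have "sqrt 3 = - x / y" using assms(3) by (simp add: field_simps)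
    then show False using sqrt_3_irrational assms(1,2) by (metis Rats_divide Rats_minus_iff)
  qed
  then show "x = 0" using assms(3) by simp
qed

text \<open>
  The real and the imaginary part have the form \<open>p + q sqrt 3\<close> with rational \<open>p\<close> and \<open>q\<close>,
  so the four rational numbers obtained vanish, and with them the coordinates.
\<close>
lemma biquad_eq_0:
  assumes roots: "(I, W) \<in> root_pairs"
    and rats: "a \<in> \<rat>" "b \<in> \<rat>" "c \<in> \<rat>" "d \<in> \<rat>"
    and zero: "biquad I W a b c d = 0"
  shows "a = 0 \<and> b = 0 \<and> c = 0 \<and> d = 0"
proof -
  have "\<exists>x\<in>\<rat>. z = complex_of_real x" if "z \<in> \<rat>" for z :: complex
  proof -
    obtain q where "z = of_rat q" using \<open>z \<in> \<rat>\<close> by (rule Rats_cases)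
    then have "z = complex_of_real (of_rat q)" by (cases q) (simp add: of_rat_rat)
    then show ?thesis using Rats_of_rat by blast
  qed
  then obtain a' b' c' d' where R: "a' \<in> \<rat>" "b' \<in> \<rat>" "c' \<in> \<rat>" "d' \<in> \<rat>"
    and eqs: "a = complex_of_real a'" "b = complex_of_real b'" "c = complex_of_real c'" "d = complex_of_real d'"
    using rats by metis
  \<comment> \<open>The signs \<open>e\<close> and \<open>f\<close> select the roots, which treats the four pairs at once.\<close>
  obtain e f :: real where ef: "e \<in> {1, - 1}" "f \<in> {1, - 1}" "I = e * \<i>" "W = Complex (1 / 2) (f * (sqrt 3 / 2))"
  proof -
    have "\<exists>e\<in>{1, - 1}. I = complex_of_real e * \<i>"
      using roots by (auto simp: root_pairs_def)
    moreover have "\<exists>f\<in>{1, - 1}. W = Complex (1 / 2) (f * (sqrt 3 / 2))"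
      using roots by (auto simp: root_pairs_def zeta_square complex_eq_iff)
    ultimately show ?thesis using that by blast
  qed
  have "(a' + c' / 2) + (- (e * f * d') / 2) * sqrt 3 = Re (biquad I W a b c d)"
    by (simp add: biquad_def eqs ef)
  with zero have 1: "(a' + c' / 2) + (- (e * f * d') / 2) * sqrt 3 = 0" by simp
  have "(e * b' + e * d' / 2) + (f * c' / 2) * sqrt 3 = Im (biquad I W a b c d)"
    by (simp add: biquad_def eqs ef field_simps)
  with zero have 2: "(e * b' + e * d' / 2) + (f * c' / 2) * sqrt 3 = 0" by simp
  have QQ: "e \<in> \<rat>" "f \<in> \<rat>" using ef by auto
  have "e * f * d' = 0" "a' + c' / 2 = 0"
    using Rats_independent_sqrt_3[OF _ _ 1] R QQ by simp_all
  moreover have "f * c' = 0" "e * b' + e * d' / 2 = 0"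
    using Rats_independent_sqrt_3[OF _ _ 2] R QQ by simp_all
  ultimately show ?thesis using ef by (auto simp: eqs)
qed

lemma biquad_diff:
  "biquad I W a b c d - biquad I W a' b' c' d' = biquad I W (a - a') (b - b') (c - c') (d - d')"
  by (simp add: biquad_def algebra_simps)

lemma biquad_inject:
  assumes "(I, W) \<in> root_pairs"
    and "a \<in> \<rat>" "b \<in> \<rat>" "c \<in> \<rat>" "d \<in> \<rat>" "a' \<in> \<rat>" "b' \<in> \<rat>" "c' \<in> \<rat>" "d' \<in> \<rat>"
    and "biquad I W a b c d = biquad I W a' b' c' d'"
  shows "a = a' \<and> b = b' \<and> c = c' \<and> d = d'"
  using biquad_eq_0[OF assms(1), of "a - a'" "b - b'" "c - c'" "d - d'"] assms
  by (simp flip: biquad_diff)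

lemma biquad_add:
  "biquad I W a b c d + biquad I W a' b' c' d' = biquad I W (a + a') (b + b') (c + c') (d + d')"
  by (simp add: biquad_def algebra_simps)

lemma biquad_mult:
  assumes "I * I = - 1" "W * W = W - 1"
  shows "biquad I W a b c d * biquad I W a' b' c' d' =
    biquad I W (a * a' - b * b' - c * c' + d * d') (a * b' + b * a' - c * d' - d * c')
      (a * c' + c * a' - b * d' - d * b' + c * c' - d * d')
      (a * d' + b * c' + c * b' + d * a' + c * d' + d * c')"
  unfolding biquad_def using assms by Groebner_Basis.algebra

text \<open>
  The set \<open>R\<close> stands for the rationals as well as for the integers. As the minimal polynomial
  of \<open>\<zeta>\<close> has coefficients \<open>0\<close> and \<open>\<plusminus>1\<close>, Horner evaluation at \<open>\<zeta>\<close> only adds and negates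
  coordinates; this keeps integer coordinates integral.
\<close>
lemma poly_zeta_biquad:
  assumes R: "0 \<in> R" "\<And>x y. x \<in> R \<Longrightarrow> y \<in> R \<Longrightarrow> x + y \<in> R" "\<And>x. x \<in> R \<Longrightarrow> - x \<in> R"
    and coeffs: "\<And>n. Polynomial.coeff f n \<in> R"
  shows "\<exists>a\<in>R. \<exists>b\<in>R. \<exists>c\<in>R. \<exists>d\<in>R. poly f zeta = biquad \<i> (zeta\<^sup>2) a b c d"
  using coeffs
proof (induction f)
  case 0
  then show ?case using R(1) by (auto simp: biquad_def intro!: bexI[of _ 0])
next
  case (pCons k f)
  have "Polynomial.coeff f n \<in> R" for n using pCons.prems[of "Suc n"] by simp
  then obtain a b c d where abcd: "a \<in> R" "b \<in> R" "c \<in> R" "d \<in> R"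
    and f: "poly f zeta = biquad \<i> (zeta\<^sup>2) a b c d"
    using pCons.IH by blast
  have k: "k \<in> R" using pCons.prems[of 0] by simp
  have "poly (pCons k f) zeta = k + \<i> * (1 - zeta\<^sup>2) * biquad \<i> (zeta\<^sup>2) a b c d"
    using f zeta_eq by simp
  also have "\<dots> = biquad \<i> (zeta\<^sup>2) (k + - (b + d)) (a + c) b (- a)"
    unfolding biquad_def using zeta_square_square i_squared by Groebner_Basis.algebra
  finally show ?case using R abcd k by blast
qed

lemma Q_zeta_iff:
  "x \<in> Q_zeta \<longleftrightarrow> (\<exists>a\<in>\<rat>. \<exists>b\<in>\<rat>. \<exists>c\<in>\<rat>. \<exists>d\<in>\<rat>. x = biquad \<i> (zeta\<^sup>2) a b c d)"
proof
  assume "x \<in> Q_zeta"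
  then obtain f :: "rat poly" where "x = poly (map_poly of_rat f) zeta" by (auto simp: Q_zeta_def)
  then show "\<exists>a\<in>\<rat>. \<exists>b\<in>\<rat>. \<exists>c\<in>\<rat>. \<exists>d\<in>\<rat>. x = biquad \<i> (zeta\<^sup>2) a b c d"
    using poly_zeta_biquad[of \<rat> "map_poly of_rat f"] by (simp add: coeff_map_poly)
next
  assume "\<exists>a\<in>\<rat>. \<exists>b\<in>\<rat>. \<exists>c\<in>\<rat>. \<exists>d\<in>\<rat>. x = biquad \<i> (zeta\<^sup>2) a b c d"
  then obtain a b c d :: rat
    where x: "x = biquad \<i> (zeta\<^sup>2) (of_rat a) (of_rat b) (of_rat c) (of_rat d)"
    unfolding Rats_def by blast
  have "x = poly (map_poly of_rat [:a, 0, c, b, 0, d:]) zeta"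
    by (simp add: x biquad_def map_poly_pCons algebra_simps power2_eq_square power3_eq_cube flip: zeta_cube)
  then show "x \<in> Q_zeta" unfolding Q_zeta_def by blast
qed

lemma Q_zeta_cases:
  assumes "x \<in> Q_zeta"
  obtains a b c d where "a \<in> \<rat>" "b \<in> \<rat>" "c \<in> \<rat>" "d \<in> \<rat>" "x = biquad \<i> (zeta\<^sup>2) a b c d"
  using assms unfolding Q_zeta_iff by blast

lemma Z_zeta_cases:
  assumes "x \<in> Z_zeta"
  obtains a b c d :: int
  where "x = biquad \<i> (zeta\<^sup>2) (of_int a) (of_int b) (of_int c) (of_int d)"
proof -
  obtain f :: "int poly" where "x = poly (map_poly of_int f) zeta"
    using assms by (auto simp: Z_zeta_def)
  then have "\<exists>a\<in>\<int>. \<exists>b\<in>\<int>. \<exists>c\<in>\<int>. \<exists>d\<in>\<int>. x = biquad \<i> (zeta\<^sup>2) a b c d"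
    using poly_zeta_biquad[of \<int> "map_poly of_int f"] by (simp add: coeff_map_poly)
  then show thesis unfolding Ints_def using that by blast
qed

section \<open>The Galois group\<close>

text \<open>
  The map with \<open>\<i> \<mapsto> I\<close> and \<open>\<zeta>\<^sup>2 \<mapsto> W\<close>, defined through the coordinates. The description
  picks one value because the coordinates are unique.
\<close>
definition galois :: "complex \<Rightarrow> complex \<Rightarrow> complex \<Rightarrow> complex" where
  "galois I W = (\<lambda>x\<in>Q_zeta. THE y. \<exists>a\<in>\<rat>. \<exists>b\<in>\<rat>. \<exists>c\<in>\<rat>. \<exists>d\<in>\<rat>.
     x = biquad \<i> (zeta\<^sup>2) a b c d \<and> y = biquad I W a b c d)"

lemma standard_root_pair: "(\<i>, zeta\<^sup>2) \<in> root_pairs"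
  by (simp add: root_pairs_def)

lemma galois_biquad:
  assumes "a \<in> \<rat>" "b \<in> \<rat>" "c \<in> \<rat>" "d \<in> \<rat>"
  shows "galois I W (biquad \<i> (zeta\<^sup>2) a b c d) = biquad I W a b c d"
proof -
  have "biquad \<i> (zeta\<^sup>2) a b c d \<in> Q_zeta" using assms Q_zeta_iff by blast
  then show ?thesis
    unfolding galois_def restrict_apply
  proof (simp, intro the_equality)
    fix y assume "\<exists>a'\<in>\<rat>. \<exists>b'\<in>\<rat>. \<exists>c'\<in>\<rat>. \<exists>d'\<in>\<rat>.
      biquad \<i> (zeta\<^sup>2) a b c d = biquad \<i> (zeta\<^sup>2) a' b' c' d' \<and> y = biquad I W a' b' c' d'"
    then show "y = biquad I W a b c d"
      using biquad_inject[OF standard_root_pair assms] by blast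
  qed (use assms in blast)
qed

lemma biquad_in_Q_zeta:
  assumes "(I, W) \<in> root_pairs" "a \<in> \<rat>" "b \<in> \<rat>" "c \<in> \<rat>" "d \<in> \<rat>"
  shows "biquad I W a b c d \<in> Q_zeta"
proof -
  have minus_i: "biquad (- \<i>) V a b c d = biquad \<i> V a (- b) c (- d)" for V a b c d
    by (simp add: biquad_def)
  have conj_w: "biquad J (1 - V) a b c d = biquad J V (a + c) (b + d) (- c) (- d)" for J V a b c d
    by (simp add: biquad_def algebra_simps)
  have "I = \<i> \<or> I = - \<i>" "W = zeta\<^sup>2 \<or> W = 1 - zeta\<^sup>2"
    using assms(1) by (auto simp: root_pairs_def)
  then show ?thesis
    using assms(2-) Q_zeta_iff minus_i conj_w by (metis Rats_add Rats_minus_iff)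
qed

text \<open>
  This is the surjectivity of the conjugation maps: replacing \<open>(\<i>, \<zeta>\<^sup>2)\<close> by another pair of
  roots is a rational change of coordinates.
\<close>
lemma Q_zeta_subset_biquad:
  assumes "(I, W) \<in> root_pairs" "x \<in> Q_zeta"
  shows "\<exists>a\<in>\<rat>. \<exists>b\<in>\<rat>. \<exists>c\<in>\<rat>. \<exists>d\<in>\<rat>. x = biquad I W a b c d"
proof -
  define P where "P J V \<longleftrightarrow> (\<exists>a\<in>\<rat>. \<exists>b\<in>\<rat>. \<exists>c\<in>\<rat>. \<exists>d\<in>\<rat>. x = biquad J V a b c d)" for J V
  have std: "P \<i> (zeta\<^sup>2)" using assms(2) unfolding P_def Q_zeta_iff .
  have minus_i: "P (- \<i>) V" if P: "P \<i> V" for V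
  proof -
    have "biquad \<i> V a b c d = biquad (- \<i>) V a (- b) c (- d)" for a b c d
      by (simp add: biquad_def)
    with P show ?thesis unfolding P_def by (metis Rats_minus_iff)
  qed
  have conj_w: "P J (1 - V)" if P: "P J V" for J V
  proof -
    have "biquad J V a b c d = biquad J (1 - V) (a + c) (b + d) (- c) (- d)" for a b c d
      by (simp add: biquad_def algebra_simps)
    with P show ?thesis unfolding P_def by (metis Rats_minus_iff Rats_add)
  qed
  have "I = \<i> \<or> I = - \<i>" "W = zeta\<^sup>2 \<or> W = 1 - zeta\<^sup>2"
    using assms(1) by (auto simp: root_pairs_def)
  then have "P I W" using std minus_i conj_w by blast
  then show ?thesis unfolding P_def .
qed

text \<open>
  Multiplicativity holds because the product formula \<open>biquad_mult\<close> uses only the quadratic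
  equations of \<open>I\<close> and \<open>W\<close>, hence is the same for all pairs of roots.
\<close>
lemma galois_in_Gal_zeta:
  assumes roots: "(I, W) \<in> root_pairs"
  shows "galois I W \<in> Gal_zeta"
proof -
  note rel = root_pairs_relations[OF roots]
  note rel0 = root_pairs_relations[OF standard_root_pair]
  have ext: "galois I W \<in> extensional Q_zeta" by (simp add: galois_def)
  have inj: "inj_on (galois I W) Q_zeta"
  proof (rule inj_onI)
    fix x y assume xy: "x \<in> Q_zeta" "y \<in> Q_zeta" and eq: "galois I W x = galois I W y"
    obtain a b c d where x: "a \<in> \<rat>" "b \<in> \<rat>" "c \<in> \<rat>" "d \<in> \<rat>" "x = biquad \<i> (zeta\<^sup>2) a b c d"
      using xy(1) by (rule Q_zeta_cases)
    obtain a' b' c' d'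
      where y: "a' \<in> \<rat>" "b' \<in> \<rat>" "c' \<in> \<rat>" "d' \<in> \<rat>" "y = biquad \<i> (zeta\<^sup>2) a' b' c' d'"
      using xy(2) by (rule Q_zeta_cases)
    have "biquad I W a b c d = biquad I W a' b' c' d'"
      using eq by (simp add: x y galois_biquad)
    then show "x = y" using biquad_inject[OF roots x(1-4) y(1-4)] by (simp add: x(5) y(5))
  qed
  have img: "galois I W ` Q_zeta = Q_zeta"
  proof (intro equalityI subsetI)
    fix y assume "y \<in> galois I W ` Q_zeta"
    then obtain a b c d where R: "a \<in> \<rat>" "b \<in> \<rat>" "c \<in> \<rat>" "d \<in> \<rat>"
      and "y = galois I W (biquad \<i> (zeta\<^sup>2) a b c d)"
      by (auto simp: Q_zeta_iff)
    then show "y \<in> Q_zeta" using biquad_in_Q_zeta[OF roots R] by (simp add: galois_biquad)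
  next
    fix y assume "y \<in> Q_zeta"
    then obtain a b c d where R: "a \<in> \<rat>" "b \<in> \<rat>" "c \<in> \<rat>" "d \<in> \<rat>" and y: "y = biquad I W a b c d"
      using Q_zeta_subset_biquad[OF roots \<open>y \<in> Q_zeta\<close>] by blast
    have "y = galois I W (biquad \<i> (zeta\<^sup>2) a b c d)" using R y by (simp add: galois_biquad)
    then show "y \<in> galois I W ` Q_zeta"
      using biquad_in_Q_zeta[OF standard_root_pair R] by blast
  qed
  have rat: "galois I W (of_rat q) = of_rat q" for q
    using galois_biquad[of "of_rat q" 0 0 0 I W] by (simp add: biquad_def)
  have hom: "galois I W (x + y) = galois I W x + galois I W y \<and>
      galois I W (x * y) = galois I W x * galois I W y"
    if xy: "x \<in> Q_zeta" "y \<in> Q_zeta" for x y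
  proof -
    obtain a b c d where x: "a \<in> \<rat>" "b \<in> \<rat>" "c \<in> \<rat>" "d \<in> \<rat>" "x = biquad \<i> (zeta\<^sup>2) a b c d"
      using xy(1) by (rule Q_zeta_cases)
    obtain a' b' c' d'
      where y: "a' \<in> \<rat>" "b' \<in> \<rat>" "c' \<in> \<rat>" "d' \<in> \<rat>" "y = biquad \<i> (zeta\<^sup>2) a' b' c' d'"
      using xy(2) by (rule Q_zeta_cases)
    show ?thesis
      by (simp add: x y galois_biquad biquad_add biquad_mult[OF rel0] biquad_mult[OF rel])
  qed
  show ?thesis
    unfolding Gal_zeta_def using ext inj img rat hom by (simp add: bij_betw_def)
qed

lemma Rats_in_Q_zeta: "a \<in> \<rat> \<Longrightarrow> a \<in> Q_zeta"
  using biquad_in_Q_zeta[OF standard_root_pair, of a 0 0 0] by (simp add: biquad_def)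

lemma Gal_zeta_on_biquad:
  assumes s: "s \<in> Gal_zeta" and R: "a \<in> \<rat>" "b \<in> \<rat>" "c \<in> \<rat>" "d \<in> \<rat>"
  shows "s (biquad \<i> (zeta\<^sup>2) a b c d) = biquad (s \<i>) (s (zeta\<^sup>2)) a b c d"
proof -
  have add: "s (x + y) = s x + s y" and mult: "s (x * y) = s x * s y"
    if "x \<in> Q_zeta" "y \<in> Q_zeta" for x y
    using s that by (auto simp: Gal_zeta_def)
  have rat: "s q = q" if "q \<in> \<rat>" for q
    using s that by (auto simp: Gal_zeta_def elim: Rats_cases)
  have Q: "biquad \<i> (zeta\<^sup>2) a b c d \<in> Q_zeta" if "a \<in> \<rat>" "b \<in> \<rat>" "c \<in> \<rat>" "d \<in> \<rat>" for a b c d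
    using biquad_in_Q_zeta[OF standard_root_pair that] .
  have lin: "a + b * \<i> \<in> Q_zeta" "s (a + b * \<i>) = a + b * s \<i>" if "a \<in> \<rat>" "b \<in> \<rat>" for a b
  proof -
    have "\<i> \<in> Q_zeta" "b * \<i> \<in> Q_zeta" "a + b * \<i> \<in> Q_zeta"
      using Q[of 0 1 0 0] Q[of 0 b 0 0] Q[of a b 0 0] that by (simp_all add: biquad_def)
    then show "a + b * \<i> \<in> Q_zeta" "s (a + b * \<i>) = a + b * s \<i>"
      using that by (simp_all add: add mult rat Rats_in_Q_zeta)
  qed
  have "zeta\<^sup>2 \<in> Q_zeta" "(c + d * \<i>) * zeta\<^sup>2 \<in> Q_zeta"
    using Q[of 0 0 1 0] Q[of 0 0 c d] R by (simp_all add: biquad_def)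
  then show ?thesis
    unfolding biquad_def using R by (simp add: add mult lin)
qed

text \<open>
  An automorphism fixes the rational coefficients of \<open>X\<^sup>2 + 1\<close> and \<open>X\<^sup>2 - X + 1\<close>, so it
  permutes the roots of each.
\<close>
lemma Gal_zeta_root_pair:
  assumes s: "s \<in> Gal_zeta"
  shows "(s \<i>, s (zeta\<^sup>2)) \<in> root_pairs"
proof -
  have mult: "s (x * y) = s x * s y" if "x \<in> Q_zeta" "y \<in> Q_zeta" for x y
    using s that by (auto simp: Gal_zeta_def)
  have rat: "s q = q" if "q \<in> \<rat>" for q
    using s that by (auto simp: Gal_zeta_def elim: Rats_cases)
  have Q: "\<i> \<in> Q_zeta" "zeta\<^sup>2 \<in> Q_zeta"
    using biquad_in_Q_zeta[OF standard_root_pair, of 0 1 0 0]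
      biquad_in_Q_zeta[OF standard_root_pair, of 0 0 1 0] by (simp_all add: biquad_def)
  have "s \<i> * s \<i> = s (- 1)" using mult[OF Q(1) Q(1)] by simp
  also have "\<dots> = - 1" by (simp add: rat)
  finally have "(s \<i> - \<i>) * (s \<i> + \<i>) = 0" by (simp add: algebra_simps)
  then have 1: "s \<i> = \<i> \<or> s \<i> = - \<i>" by (simp add: add_eq_0_iff2)
  have "s (zeta\<^sup>2) * s (zeta\<^sup>2) = s (biquad \<i> (zeta\<^sup>2) (- 1) 0 1 0)"
    using mult[OF Q(2) Q(2), symmetric] unfolding zeta_square_square biquad_def by simp
  also have "\<dots> = s (zeta\<^sup>2) - 1"
    by (subst Gal_zeta_on_biquad[OF s]) (simp_all add: biquad_def)
  finally have "(s (zeta\<^sup>2) - zeta\<^sup>2) * (s (zeta\<^sup>2) - (1 - zeta\<^sup>2)) = 0"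
    using zeta_square_square by Groebner_Basis.algebra
  then have "s (zeta\<^sup>2) = zeta\<^sup>2 \<or> s (zeta\<^sup>2) = 1 - zeta\<^sup>2" by simp
  with 1 show ?thesis unfolding root_pairs_def by blast
qed

lemma Gal_zeta_eq: "Gal_zeta = (\<lambda>(I, W). galois I W) ` root_pairs"
proof (intro equalityI subsetI)
  fix s assume s: "s \<in> Gal_zeta"
  have "s = galois (s \<i>) (s (zeta\<^sup>2))"
  proof (rule extensionalityI[of _ Q_zeta])
    show "s \<in> extensional Q_zeta" using s by (simp add: Gal_zeta_def)
    show "galois (s \<i>) (s (zeta\<^sup>2)) \<in> extensional Q_zeta" by (simp add: galois_def)
    fix x assume "x \<in> Q_zeta"
    then show "s x = galois (s \<i>) (s (zeta\<^sup>2)) x"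
      by (rule Q_zeta_cases) (simp add: galois_biquad Gal_zeta_on_biquad[OF s])
  qed
  then show "s \<in> (\<lambda>(I, W). galois I W) ` root_pairs"
    using Gal_zeta_root_pair[OF s] by force
qed (auto simp: galois_in_Gal_zeta)

lemma inj_on_galois: "inj_on (\<lambda>(I, W). galois I W) root_pairs"
proof -
  have "galois I W \<i> = I" "galois I W (zeta\<^sup>2) = W" for I W
    using galois_biquad[of 0 1 0 0 I W] galois_biquad[of 0 0 1 0 I W]
    by (simp_all add: biquad_def)
  then show ?thesis by (intro inj_on_inverseI[where g = "\<lambda>s. (s \<i>, s (zeta\<^sup>2))"]) auto
qed

section \<open>The norm as a value of both forms\<close>

lemma norm_zeta_biquad:
  assumes "a \<in> \<rat>" "b \<in> \<rat>" "c \<in> \<rat>" "d \<in> \<rat>"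
  shows "norm_zeta (biquad \<i> (zeta\<^sup>2) a b c d) =
    (\<Prod>(I, W)\<in>root_pairs. biquad I W a b c d)"
  unfolding norm_zeta_def Gal_zeta_eq
  by (subst prod.reindex[OF inj_on_galois]) (simp add: case_prod_beta galois_biquad assms)

lemma prod_root_pairs:
  "(\<Prod>(I, W)\<in>root_pairs. f I W) =
    (f \<i> (zeta\<^sup>2) * f \<i> (1 - zeta\<^sup>2)) * (f (- \<i>) (zeta\<^sup>2) * f (- \<i>) (1 - zeta\<^sup>2))"
proof -
  have "zeta\<^sup>2 \<noteq> 1 - zeta\<^sup>2" by (simp add: zeta_square complex_eq_iff)
  then show ?thesis
    unfolding root_pairs_def by (simp add: mult.assoc flip: prod.cartesian_product)
qed

text \<open>
  Transitivity of the norm through \<open>\<rat>(\<i>)\<close>: with \<open>A = a + b \<i>\<close> and \<open>B = c + d \<i>\<close>, the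
  two conjugates over \<open>\<rat>(\<i>)\<close> multiply to \<open>A\<^sup>2 + A B + B\<^sup>2 = x + y \<i>\<close>.
\<close>
lemma norm_zeta_gauss_form:
  fixes a b c d :: int
  defines "x \<equiv> a\<^sup>2 - b\<^sup>2 + a * c - b * d + c\<^sup>2 - d\<^sup>2"
    and "y \<equiv> 2 * a * b + a * d + b * c + 2 * c * d"
  shows "norm_zeta (biquad \<i> (zeta\<^sup>2) (of_int a) (of_int b) (of_int c) (of_int d)) =
    of_int (x\<^sup>2 + y\<^sup>2)"
proof -
  have rel: "biquad I (zeta\<^sup>2) (of_int a) (of_int b) (of_int c) (of_int d) *
      biquad I (1 - zeta\<^sup>2) (of_int a) (of_int b) (of_int c) (of_int d) = of_int x + of_int y * I"
    if "I * I = - 1" for I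
    unfolding biquad_def x_def y_def of_int_add of_int_diff of_int_mult of_int_power of_int_numeral
    using that zeta_square_square by Groebner_Basis.algebra
  have "norm_zeta (biquad \<i> (zeta\<^sup>2) (of_int a) (of_int b) (of_int c) (of_int d)) =
    (of_int x + of_int y * \<i>) * (of_int x + of_int y * - \<i>)"
    by (simp only: norm_zeta_biquad prod_root_pairs Rats_of_int rel i_squared minus_mult_minus)
  also have "\<dots> = of_int (x\<^sup>2 + y\<^sup>2)"
    unfolding of_int_add of_int_power using i_squared by Groebner_Basis.algebra
  finally show ?thesis .
qed

text \<open>
  Transitivity of the norm through \<open>\<rat>(\<omega>)\<close>: with \<open>C = a + c \<omega>\<close> and \<open>D = b + d \<omega>\<close>, the
  two conjugates over \<open>\<rat>(\<omega>)\<close> multiply to \<open>C\<^sup>2 + D\<^sup>2 = u + v \<omega>\<close>.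
\<close>
lemma norm_zeta_eisenstein_form:
  fixes a b c d :: int
  defines "u \<equiv> a\<^sup>2 - c\<^sup>2 + b\<^sup>2 - d\<^sup>2" and "v \<equiv> 2 * a * c + c\<^sup>2 + 2 * b * d + d\<^sup>2"
  shows "norm_zeta (biquad \<i> (zeta\<^sup>2) (of_int a) (of_int b) (of_int c) (of_int d)) =
    of_int (u\<^sup>2 + u * v + v\<^sup>2)"
proof -
  have rel: "biquad \<i> W (of_int a) (of_int b) (of_int c) (of_int d) *
      biquad (- \<i>) W (of_int a) (of_int b) (of_int c) (of_int d) = of_int u + of_int v * W"
    if "W * W = W - 1" for W
    unfolding biquad_def u_def v_def of_int_add of_int_diff of_int_mult of_int_power of_int_numeral
    using that i_squared by Groebner_Basis.algebra
  have W: "(1 - zeta\<^sup>2) * (1 - zeta\<^sup>2) = (1 - zeta\<^sup>2) - 1"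
    using zeta_square_square by Groebner_Basis.algebra
  have "norm_zeta (biquad \<i> (zeta\<^sup>2) (of_int a) (of_int b) (of_int c) (of_int d)) =
    (of_int u + of_int v * zeta\<^sup>2) * (of_int u + of_int v * (1 - zeta\<^sup>2))"
    unfolding rel[OF zeta_square_square, symmetric] rel[OF W, symmetric]
    by (simp only: norm_zeta_biquad prod_root_pairs Rats_of_int mult_ac)
  also have "\<dots> = of_int (u\<^sup>2 + u * v + v\<^sup>2)"
    unfolding of_int_add of_int_mult of_int_power using zeta_square_square by Groebner_Basis.algebra
  finally show ?thesis .
qed

lemma norm_zeta_nonzero:
  assumes "a \<in> \<rat>" "b \<in> \<rat>" "c \<in> \<rat>" "d \<in> \<rat>" "biquad \<i> (zeta\<^sup>2) a b c d \<noteq> 0"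
  shows "norm_zeta (biquad \<i> (zeta\<^sup>2) a b c d) \<noteq> 0"
proof -
  have "biquad I W a b c d \<noteq> 0" if "(I, W) \<in> root_pairs" for I W
    using biquad_eq_0[OF that assms(1-4)] assms(5) by (auto simp: biquad_def)
  moreover have "finite root_pairs" by (simp add: root_pairs_def)
  ultimately show ?thesis
    by (auto simp: norm_zeta_biquad assms(1-4))
qed

section \<open>The prime decomposition of a norm\<close>

theorem theorem5:
  fixes r :: complex
  assumes "\<exists>\<alpha>\<in>Z_zeta. \<alpha> \<noteq> 0 \<and> norm_zeta \<alpha> = r"
  shows "\<exists>n::nat. n > 0 \<and> r = of_nat n \<and>
    (\<exists>(\<rho> :: nat \<Rightarrow> nat) P Q W Z.
       finite P \<and> finite Q \<and> finite W \<and> finite Z \<and>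
       (\<forall>p\<in>P. prime p \<and> p mod 12 = 1) \<and>
       (\<forall>q\<in>Q. prime q \<and> q mod 12 = 11) \<and>
       (\<forall>w\<in>W. prime w \<and> w mod 12 = 5) \<and>
       (\<forall>z\<in>Z. prime z \<and> z mod 12 = 7) \<and>
       n = 2 ^ (2 * \<rho> 2) * 3 ^ (2 * \<rho> 3) *
           (\<Prod>p\<in>P. p ^ \<rho> p) * (\<Prod>q\<in>Q. q ^ (2 * \<rho> q)) *
           (\<Prod>w\<in>W. w ^ (2 * \<rho> w)) * (\<Prod>z\<in>Z. z ^ (2 * \<rho> z)))"
proof -
  obtain \<alpha> where \<alpha>: "\<alpha> \<in> Z_zeta" "\<alpha> \<noteq> 0" "norm_zeta \<alpha> = r" using assms by blast
  obtain a b c d :: int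
    where abcd: "\<alpha> = biquad \<i> (zeta\<^sup>2) (of_int a) (of_int b) (of_int c) (of_int d)"
    using \<alpha>(1) by (rule Z_zeta_cases)
  obtain x y u v :: int
    where gauss: "r = of_int (x\<^sup>2 + y\<^sup>2)" and eisen: "r = of_int (u\<^sup>2 + u * v + v\<^sup>2)"
    using norm_zeta_gauss_form norm_zeta_eisenstein_form \<alpha>(3) abcd by metis
  have "r \<noteq> 0" using norm_zeta_nonzero \<alpha>(2,3) abcd by force
  define n where "n = nat (x\<^sup>2 + y\<^sup>2)"
  have n: "int n = x\<^sup>2 + y\<^sup>2" by (simp add: n_def)
  then have r: "r = of_nat n" using gauss by (metis of_int_of_nat_eq)
  have "int n = u\<^sup>2 + u * v + v\<^sup>2" using eisen r by (metis of_int_eq_iff of_int_of_nat_eq)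
  moreover have pos: "n > 0" using r \<open>r \<noteq> 0\<close> by (cases n) auto
  ultimately have "even (multiplicity p n)" if "prime p" "p mod 12 \<noteq> 1" for p
    using even_multiplicity_of_both_forms n that by blast
  then show ?thesis using prime_decomposition_of_even_multiplicities[OF pos] pos r by blast
qed

end
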